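(* If $K$ is an AEC and $\lambda$ is a cardinal with $LS(K)<\kappa\le\lambda$, then the non-forking relation $\downarrow$ satisfies Invariance (I), Monotonicity (M), Transitivity (T), and Continuity $(C)_{<\kappa}$.
   Context: $K$ is an AEC with strong substructure $\prec$ and Löwenheim–Skolem number $LS(K)$, with amalgamation, joint embedding and no maximal models; one works in a monster model $\mathfrak{C}$. Galois type $tp(\bar a/M)$ of a sequence over a model $M$ = orbit of $\bar a$ under automorphisms of $\mathfrak{C}$ fixing $M$ pointwise. $\kappa>LS(K)$ is the fixed cardinal; non-forking: for models $M_0\prec N$ and a set $A$, $A\downarrow_{M_0}N$ iff for every subsequence $a$ of $A$ of length $<\kappa$ and every $N^-\prec N$ with $\|N^-\|<\kappa$, $tp(a/N^-)$ is realized in $M_0$ (i.e. by a tuple of elements of $M_0$). (I): if $f\in\mathrm{Aut}\,\mathfrak{C}$ and $A\downarrow_{M_0}N$ then $f(A)\downarrow_{f(M_0)}f(N)$. (M): if $A\downarrow_{M_0}N$, $A'\subseteq A$ and $M_0\prec M_0'\prec N'\prec N$, then $A'\downarrow_{M_0'}N'$. (T): if $A\downarrow_{M_0'}N$, $M_0'\downarrow_{M_0}N$ and $M_0\prec M_0'$, then $A\downarrow_{M_0}N$. $(C)_{<\kappa}$: (a) if for all $A'\subseteq A$ with $|A'|<\kappa$ and all $N'\prec N$ with $\|N'\|<\kappa$ there are $M_0'\prec M_0$ and $N'\prec N^*\prec N$ with $M_0'\prec N^*$ and $A'\downarrow_{M_0'}N^*$, then $A\downarrow_{M_0}N$; (b)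 if $\langle A_i:i<\kappa\rangle$ and $\langle M_0^i:i<\kappa\rangle$ are filtrations (increasing continuous sequences with unions $A$ and $M_0$) and $A_i\downarrow_{M_0^i}N$ for all $i<\kappa$, then $A\downarrow_{M_0}N$.
   Formalization: Part (b) of Continuity (C)_{<κ} is asserted only for regular κ, since for singular κ it fails with filtrations as defined; (I), (M), (T) and part (a) are asserted for every κ > LS(K). *)

theory Defs
  imports Main "HOL-Library.FuncSet"
begin

unbundle cardinal_syntax
record ('f, 'r) lang =
  fun_syms :: "'f set"
  rel_syms :: "'r set"
  fun_ar :: "'f \<Rightarrow> nat"
  rel_ar :: "'r \<Rightarrow> nat"

record ('a, 'f, 'r) struct =
  carrier :: "'a set"
  fun_of :: "'f \<Rightarrow> 'a list \<Rightarrow> 'a"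
  rel_of :: "'r \<Rightarrow> 'a list set"

definition tuples :: "'a set \<Rightarrow> nat \<Rightarrow> 'a list set" where
  "tuples X n = {xs. set xs \<subseteq> X \<and> length xs = n}"

text \<open>Interpretations are extensional (fixed to \<open>undefined\<close> or empty where they carry no
  meaning), so that equality of records is equality of structures.\<close>

definition is_struct :: "('f, 'r) lang \<Rightarrow> ('a, 'f, 'r) struct \<Rightarrow> bool" where
  "is_struct L M \<longleftrightarrow>
     carrier M \<noteq> {} \<and>
     (\<forall>F xs. if F \<in> fun_syms L \<and> xs \<in> tuples (carrier M) (fun_ar L F)
        then fun_of M F xs \<in> carrier M else fun_of M F xs = undefined) \<and>
     (\<forall>R. rel_of M R \<subseteq> (if R \<in> rel_syms L then tuples (carrier M) (rel_ar L R) else {}))"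

definition substruct ::
  "('f, 'r) lang \<Rightarrow> ('a, 'f, 'r) struct \<Rightarrow> ('a, 'f, 'r) struct \<Rightarrow> bool" where
  "substruct L M N \<longleftrightarrow>
     is_struct L M \<and> is_struct L N \<and> carrier M \<subseteq> carrier N \<and>
     (\<forall>F \<in> fun_syms L. \<forall>xs \<in> tuples (carrier M) (fun_ar L F). fun_of M F xs = fun_of N F xs) \<and>
     (\<forall>R \<in> rel_syms L. rel_of M R = rel_of N R \<inter> tuples (carrier M) (rel_ar L R))"

definition isom ::
  "('f, 'r) lang \<Rightarrow> ('a \<Rightarrow> 'a) \<Rightarrow> ('a, 'f, 'r) struct \<Rightarrow> ('a, 'f, 'r) struct \<Rightarrow> bool" where
  "isom L f M N \<longleftrightarrow>
     is_struct L M \<and> is_struct L N \<and> bij_betw f (carrier M) (carrier N) \<and>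
     (\<forall>F \<in> fun_syms L. \<forall>xs \<in> tuples (carrier M) (fun_ar L F).
        f (fun_of M F xs) = fun_of N F (map f xs)) \<and>
     (\<forall>R \<in> rel_syms L. \<forall>xs \<in> tuples (carrier M) (rel_ar L R).
        xs \<in> rel_of M R \<longleftrightarrow> map f xs \<in> rel_of N R)"

definition aut :: "('f, 'r) lang \<Rightarrow> ('a, 'f, 'r) struct \<Rightarrow> ('a \<Rightarrow> 'a) set" where
  "aut L M = {f. isom L f M M}"

definition image_struct ::
  "('f, 'r) lang \<Rightarrow> ('a \<Rightarrow> 'a) \<Rightarrow> ('a, 'f, 'r) struct \<Rightarrow> ('a, 'f, 'r) struct" where
  "image_struct L f M =
     \<lparr>carrier = f ` carrier M,
      fun_of = (\<lambda>F ys. if F \<in> fun_syms L \<and> ys \<in> tuples (f ` carrier M) (fun_ar L F)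
                  then f (fun_of M F (map (inv_into (carrier M) f) ys)) else undefined),
      rel_of = (\<lambda>R. map f ` rel_of M R)\<rparr>"

text \<open>For a family directed under \<^const>\<open>substruct\<close> (the only use below) this determines
  \<open>U\<close> uniquely.\<close>

definition is_union ::
  "('f, 'r) lang \<Rightarrow> ('a, 'f, 'r) struct set \<Rightarrow> ('a, 'f, 'r) struct \<Rightarrow> bool" where
  "is_union L S U \<longleftrightarrow>
     is_struct L U \<and> carrier U = (\<Union>M\<in>S. carrier M) \<and> (\<forall>M\<in>S. substruct L M U)"

text \<open>An ordinal is represented by a well-order \<open>r\<close>; the ordinals below it are the elements
  of \<open>Field r\<close>, the element \<open>i\<close> having the set of predecessors \<open>underS r i\<close>.\<close>

definition limit_ordinal :: "'i rel \<Rightarrow> bool" where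
  "limit_ordinal r \<longleftrightarrow>
     Well_order r \<and> Field r \<noteq> {} \<and> (\<forall>i \<in> Field r. \<exists>j \<in> Field r. i \<in> underS r j)"

definition limit_index :: "'i rel \<Rightarrow> 'i \<Rightarrow> bool" where
  "limit_index r i \<longleftrightarrow>
     i \<in> Field r \<and> underS r i \<noteq> {} \<and> (\<forall>j \<in> underS r i. \<exists>k \<in> underS r i. j \<in> underS r k)"

definition cont_chain ::
  "('f, 'r) lang \<Rightarrow> (('a, 'f, 'r) struct \<Rightarrow> ('a, 'f, 'r) struct \<Rightarrow> bool) \<Rightarrow>
   'i rel \<Rightarrow> ('i \<Rightarrow> ('a, 'f, 'r) struct) \<Rightarrow> bool" where
  "cont_chain L le r Ms \<longleftrightarrow>
     (\<forall>i j. (i, j) \<in> r \<longrightarrow> le (Ms i) (Ms j)) \<and>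
     (\<forall>i. limit_index r i \<longrightarrow> is_union L (Ms ` underS r i) (Ms i))"

definition model_filtration ::
  "('f, 'r) lang \<Rightarrow> (('a, 'f, 'r) struct \<Rightarrow> ('a, 'f, 'r) struct \<Rightarrow> bool) \<Rightarrow>
   'i rel \<Rightarrow> ('i \<Rightarrow> ('a, 'f, 'r) struct) \<Rightarrow> ('a, 'f, 'r) struct \<Rightarrow> bool" where
  "model_filtration L le r Ms M \<longleftrightarrow> cont_chain L le r Ms \<and> is_union L (Ms ` Field r) M"

definition set_filtration :: "'i rel \<Rightarrow> ('i \<Rightarrow> 'a set) \<Rightarrow> 'a set \<Rightarrow> bool" where
  "set_filtration r As A \<longleftrightarrow>
     (\<forall>i j. (i, j) \<in> r \<longrightarrow> As i \<subseteq> As j) \<and>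
     (\<forall>i. limit_index r i \<longrightarrow> As i = (\<Union>j \<in> underS r i. As j)) \<and>
     A = (\<Union>i \<in> Field r. As i)"

definition LS_bound ::
  "('f, 'r) lang \<Rightarrow> ('a, 'f, 'r) struct set \<Rightarrow>
   (('a, 'f, 'r) struct \<Rightarrow> ('a, 'f, 'r) struct \<Rightarrow> bool) \<Rightarrow> 'l rel \<Rightarrow> bool" where
  "LS_bound L K le \<theta> \<longleftrightarrow>
     Card_order \<theta> \<and> natLeq +c |fun_syms L <+> rel_syms L| \<le>o \<theta> \<and>
     (\<forall>M \<in> K. \<forall>A. A \<subseteq> carrier M \<longrightarrow>
        (\<exists>N. le N M \<and> A \<subseteq> carrier N \<and> |carrier N| \<le>o |A| +c \<theta>))"

text \<open>The elements of models are drawn from the type \<open>'a\<close>, so \<open>K\<close> is the set of all models on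
  subsets of \<open>'a\<close>. A strictly increasing chain of such models has a length of cardinality at
  most that of \<open>'a\<close>, so well-orders on \<open>'a\<close> suffice as index ordinals in the chain axioms.
  Likewise a cardinal smaller than \<open>LS\<close> is represented on the type of \<open>LS\<close>, so the
  minimality of \<open>LS\<close> is expressed by \<open>LS_least\<close>.\<close>

locale aec =
  fixes L :: "('f, 'r) lang"
    and K :: "('a, 'f, 'r) struct set"
    and le :: "('a, 'f, 'r) struct \<Rightarrow> ('a, 'f, 'r) struct \<Rightarrow> bool"
    and LS :: "'l rel"
  assumes K_struct: "M \<in> K \<Longrightarrow> is_struct L M"
    and K_iso: "M \<in> K \<Longrightarrow> isom L f M N \<Longrightarrow> N \<in> K"
    and le_iso: "le M N \<Longrightarrow> isom L f N N' \<Longrightarrow> isom L f M M' \<Longrightarrow> le M' N'"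
    and le_K: "le M N \<Longrightarrow> M \<in> K \<and> N \<in> K"
    and le_refl: "M \<in> K \<Longrightarrow> le M M"
    and le_trans: "le M N \<Longrightarrow> le N P \<Longrightarrow> le M P"
    and le_substruct: "le M N \<Longrightarrow> substruct L M N"
    and coherence: "le M P \<Longrightarrow> le N P \<Longrightarrow> substruct L M N \<Longrightarrow> le M N"
    and chain_K:
      "limit_ordinal (r :: 'a rel) \<Longrightarrow> cont_chain L le r Ms \<Longrightarrow> is_union L (Ms ` Field r) U \<Longrightarrow>
       U \<in> K"
    and chain_le:
      "limit_ordinal (r :: 'a rel) \<Longrightarrow> cont_chain L le r Ms \<Longrightarrow> is_union L (Ms ` Field r) U \<Longrightarrow>
       i \<in> Field r \<Longrightarrow> le (Ms i) U"
    and chain_le_bound: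
      "limit_ordinal (r :: 'a rel) \<Longrightarrow> cont_chain L le r Ms \<Longrightarrow> is_union L (Ms ` Field r) U \<Longrightarrow>
       (\<And>i. i \<in> Field r \<Longrightarrow> le (Ms i) N) \<Longrightarrow> le U N"
    and LS_bound: "LS_bound L K le LS"
    and LS_least: "LS_bound L K le (\<theta> :: 'l rel) \<Longrightarrow> LS \<le>o \<theta>"

definition K_embedding ::
  "('f, 'r) lang \<Rightarrow> (('a, 'f, 'r) struct \<Rightarrow> ('a, 'f, 'r) struct \<Rightarrow> bool) \<Rightarrow>
   ('a \<Rightarrow> 'a) \<Rightarrow> ('a, 'f, 'r) struct \<Rightarrow> ('a, 'f, 'r) struct \<Rightarrow> bool" where
  "K_embedding L le f M N \<longleftrightarrow> (\<exists>M'. isom L f M M' \<and> le M' N)"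

definition amalgamation ::
  "('f, 'r) lang \<Rightarrow> ('a, 'f, 'r) struct set \<Rightarrow>
   (('a, 'f, 'r) struct \<Rightarrow> ('a, 'f, 'r) struct \<Rightarrow> bool) \<Rightarrow> bool" where
  "amalgamation L K le \<longleftrightarrow>
     (\<forall>M0 M1 M2. le M0 M1 \<and> le M0 M2 \<longrightarrow>
        (\<exists>N \<in> K. \<exists>f g. K_embedding L le f M1 N \<and> K_embedding L le g M2 N \<and>
           (\<forall>x \<in> carrier M0. f x = g x)))"

definition joint_embedding ::
  "('f, 'r) lang \<Rightarrow> ('a, 'f, 'r) struct set \<Rightarrow>
   (('a, 'f, 'r) struct \<Rightarrow> ('a, 'f, 'r) struct \<Rightarrow> bool) \<Rightarrow> bool" where
  "joint_embedding L K le \<longleftrightarrow>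
     (\<forall>M1 \<in> K. \<forall>M2 \<in> K. \<exists>N \<in> K. \<exists>f g. K_embedding L le f M1 N \<and> K_embedding L le g M2 N)"

text \<open>Stated up to isomorphism: a model whose carrier exhausts \<open>'a\<close> has no room for a proper
  extension inside \<open>'a\<close>, but it can still embed properly into another model on \<open>'a\<close>.\<close>

definition no_maximal_models ::
  "('f, 'r) lang \<Rightarrow> ('a, 'f, 'r) struct set \<Rightarrow>
   (('a, 'f, 'r) struct \<Rightarrow> ('a, 'f, 'r) struct \<Rightarrow> bool) \<Rightarrow> bool" where
  "no_maximal_models L K le \<longleftrightarrow>
     (\<forall>M \<in> K. \<exists>N \<in> K. \<exists>f. K_embedding L le f M N \<and> f ` carrier M \<noteq> carrier N)"

text \<open>The monster is universal and strongly model-homogeneous for models of size below \<open>\<mu>\<close>;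
  all models and sets considered are inside it and of size below \<open>\<mu>\<close>.\<close>

definition monster ::
  "('f, 'r) lang \<Rightarrow> ('a, 'f, 'r) struct set \<Rightarrow>
   (('a, 'f, 'r) struct \<Rightarrow> ('a, 'f, 'r) struct \<Rightarrow> bool) \<Rightarrow>
   ('a, 'f, 'r) struct \<Rightarrow> 'm rel \<Rightarrow> bool" where
  "monster L K le \<CC> \<mu> \<longleftrightarrow>
     \<CC> \<in> K \<and> Card_order \<mu> \<and> \<mu> \<le>o |carrier \<CC>| \<and>
     (\<forall>M \<in> K. |carrier M| <o \<mu> \<longrightarrow> (\<exists>f. K_embedding L le f M \<CC>)) \<and>
     (\<forall>M N f. le M \<CC> \<and> le N \<CC> \<and> |carrier M| <o \<mu> \<and> isom L f M N \<longrightarrow>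
        (\<exists>g \<in> aut L \<CC>. \<forall>x \<in> carrier M. g x = f x))"

definition small_model ::
  "(('a, 'f, 'r) struct \<Rightarrow> ('a, 'f, 'r) struct \<Rightarrow> bool) \<Rightarrow>
   ('a, 'f, 'r) struct \<Rightarrow> 'm rel \<Rightarrow> ('a, 'f, 'r) struct \<Rightarrow> bool" where
  "small_model le \<CC> \<mu> M \<longleftrightarrow> le M \<CC> \<and> |carrier M| <o \<mu>"

definition small_set :: "('a, 'f, 'r) struct \<Rightarrow> 'm rel \<Rightarrow> 'a set \<Rightarrow> bool" where
  "small_set \<CC> \<mu> A \<longleftrightarrow> A \<subseteq> carrier \<CC> \<and> |A| <o \<mu>"

text \<open>The orbit of the sequence \<open>a\<close> with index set \<open>I\<close> under the automorphisms of \<open>\<CC>\<close> that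
  fix \<open>M\<close> pointwise.\<close>

definition gtp ::
  "('f, 'r) lang \<Rightarrow> ('a, 'f, 'r) struct \<Rightarrow> 'i set \<Rightarrow> ('i \<Rightarrow> 'a) \<Rightarrow> ('a, 'f, 'r) struct \<Rightarrow>
   ('i \<Rightarrow> 'a) set" where
  "gtp L \<CC> I a M = {restrict (f \<circ> a) I | f. f \<in> aut L \<CC> \<and> (\<forall>x \<in> carrier M. f x = x)}"

text \<open>A sequence of length \<open>< \<kappa>\<close> is one indexed by \<open>underS \<kappa> \<alpha>\<close> for some \<open>\<alpha> \<in> Field \<kappa>\<close>.\<close>

definition nonforking ::
  "('f, 'r) lang \<Rightarrow> (('a, 'f, 'r) struct \<Rightarrow> ('a, 'f, 'r) struct \<Rightarrow> bool) \<Rightarrow>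
   ('a, 'f, 'r) struct \<Rightarrow> 'm rel \<Rightarrow> 'k rel \<Rightarrow>
   'a set \<Rightarrow> ('a, 'f, 'r) struct \<Rightarrow> ('a, 'f, 'r) struct \<Rightarrow> bool" where
  "nonforking L le \<CC> \<mu> \<kappa> A M0 N \<longleftrightarrow>
     small_set \<CC> \<mu> A \<and> small_model le \<CC> \<mu> M0 \<and> small_model le \<CC> \<mu> N \<and> le M0 N \<and>
     (\<forall>\<alpha> \<in> Field \<kappa>. \<forall>a :: 'k \<Rightarrow> 'a. \<forall>N'.
        a ` underS \<kappa> \<alpha> \<subseteq> A \<and> le N' N \<and> |carrier N'| <o \<kappa> \<longrightarrow>
        (\<exists>b. b ` underS \<kappa> \<alpha> \<subseteq> carrier M0 \<and>
             gtp L \<CC> (underS \<kappa> \<alpha>) b N' = gtp L \<CC> (underS \<kappa> \<alpha>) a N'))"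

definition Invariance ::
  "('f, 'r) lang \<Rightarrow> ('a, 'f, 'r) struct \<Rightarrow>
   ('a set \<Rightarrow> ('a, 'f, 'r) struct \<Rightarrow> ('a, 'f, 'r) struct \<Rightarrow> bool) \<Rightarrow> bool" where
  "Invariance L \<CC> nf \<longleftrightarrow>
     (\<forall>f A M0 N. f \<in> aut L \<CC> \<and> nf A M0 N \<longrightarrow>
        nf (f ` A) (image_struct L f M0) (image_struct L f N))"

definition Monotonicity ::
  "(('a, 'f, 'r) struct \<Rightarrow> ('a, 'f, 'r) struct \<Rightarrow> bool) \<Rightarrow>
   ('a set \<Rightarrow> ('a, 'f, 'r) struct \<Rightarrow> ('a, 'f, 'r) struct \<Rightarrow> bool) \<Rightarrow> bool" where
  "Monotonicity le nf \<longleftrightarrow>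
     (\<forall>A A' M0 M0' N' N. nf A M0 N \<and> A' \<subseteq> A \<and> le M0 M0' \<and> le M0' N' \<and> le N' N \<longrightarrow>
        nf A' M0' N')"

definition Transitivity ::
  "(('a, 'f, 'r) struct \<Rightarrow> ('a, 'f, 'r) struct \<Rightarrow> bool) \<Rightarrow>
   ('a set \<Rightarrow> ('a, 'f, 'r) struct \<Rightarrow> ('a, 'f, 'r) struct \<Rightarrow> bool) \<Rightarrow> bool" where
  "Transitivity le nf \<longleftrightarrow>
     (\<forall>A M0 M0' N. nf A M0' N \<and> nf (carrier M0') M0 N \<and> le M0 M0' \<longrightarrow> nf A M0 N)"

definition Continuity_a ::
  "(('a, 'f, 'r) struct \<Rightarrow> ('a, 'f, 'r) struct \<Rightarrow> bool) \<Rightarrow>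
   ('a, 'f, 'r) struct \<Rightarrow> 'm rel \<Rightarrow> 'k rel \<Rightarrow>
   ('a set \<Rightarrow> ('a, 'f, 'r) struct \<Rightarrow> ('a, 'f, 'r) struct \<Rightarrow> bool) \<Rightarrow> bool" where
  "Continuity_a le \<CC> \<mu> \<kappa> nf \<longleftrightarrow>
     (\<forall>A M0 N. small_set \<CC> \<mu> A \<and> small_model le \<CC> \<mu> M0 \<and> small_model le \<CC> \<mu> N \<and> le M0 N \<and>
        (\<forall>A' N'. A' \<subseteq> A \<and> |A'| <o \<kappa> \<and> le N' N \<and> |carrier N'| <o \<kappa> \<longrightarrow>
           (\<exists>M0' Ns. le M0' M0 \<and> le N' Ns \<and> le Ns N \<and> le M0' Ns \<and> nf A' M0' Ns)) \<longrightarrow>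
        nf A M0 N)"

text \<open>For singular \<open>\<kappa>\<close> a sequence of length \<open>cf \<kappa> < \<kappa>\<close> in \<open>A\<close> need not lie in any \<open>As i\<close>, and
  this property of \<open>nonforking\<close> can then fail.\<close>

definition Continuity_b ::
  "('f, 'r) lang \<Rightarrow> (('a, 'f, 'r) struct \<Rightarrow> ('a, 'f, 'r) struct \<Rightarrow> bool) \<Rightarrow>
   ('a, 'f, 'r) struct \<Rightarrow> 'm rel \<Rightarrow> 'k rel \<Rightarrow>
   ('a set \<Rightarrow> ('a, 'f, 'r) struct \<Rightarrow> ('a, 'f, 'r) struct \<Rightarrow> bool) \<Rightarrow> bool" where
  "Continuity_b L le \<CC> \<mu> \<kappa> nf \<longleftrightarrow>
     (\<forall>As A Ms M0 N. small_set \<CC> \<mu> A \<and> small_model le \<CC> \<mu> M0 \<and> small_model le \<CC> \<mu> N \<and>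
        set_filtration \<kappa> As A \<and> model_filtration L le \<kappa> Ms M0 \<and>
        (\<forall>i \<in> Field \<kappa>. nf (As i) (Ms i) N) \<longrightarrow>
        nf A M0 N)"

end

theory Submission
  imports Defs
begin

text \<open>Two sequences in \<open>\<CC>\<close> have the same Galois type over \<open>M\<close> iff an automorphism fixing \<open>M\<close>
  carries one to the other. With this, (I) is conjugation by the automorphism, (M) and (C)(a)
  only shrink or enlarge the sets over which one quantifies, and (T) composes two realizations.
  For (C)(b), regularity of \<open>\<kappa>\<close> puts every sequence of length \<open>< \<kappa>\<close> inside a single \<open>A\<^sub>i\<close>; that
  the union of the \<open>M\<^sub>0\<^sup>i\<close> is strong in \<open>N\<close> follows from coherence, since both are strong in \<open>\<CC>\<close>.\<close>

section \<open>Isomorphisms and automorphisms\<close>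

lemma map_tuples:
  assumes "xs \<in> tuples X n" "f ` X \<subseteq> Y"
  shows "map f xs \<in> tuples Y n"
  using assms by (fastforce simp: tuples_def)

lemma fun_of_closed:
  assumes "is_struct L M" "F \<in> fun_syms L" "xs \<in> tuples (carrier M) (fun_ar L F)"
  shows "fun_of M F xs \<in> carrier M"
  using assms unfolding is_struct_def by meson

lemma isomD:
  assumes "isom L f M N"
  shows "is_struct L M" "is_struct L N" "bij_betw f (carrier M) (carrier N)"
    and "F \<in> fun_syms L \<Longrightarrow> xs \<in> tuples (carrier M) (fun_ar L F) \<Longrightarrow>
      f (fun_of M F xs) = fun_of N F (map f xs)"
    and "R \<in> rel_syms L \<Longrightarrow> xs \<in> tuples (carrier M) (rel_ar L R) \<Longrightarrow>
      xs \<in> rel_of M R \<longleftrightarrow> map f xs \<in> rel_of N R"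
  using assms unfolding isom_def by blast+

lemma isom_id:
  assumes "is_struct L M"
  shows "isom L id M M"
  using assms by (simp add: isom_def)

lemma isom_comp:
  assumes f: "isom L f M N" and g: "isom L g N P"
  shows "isom L (g \<circ> f) M P"
proof -
  have bij: "bij_betw f (carrier M) (carrier N)" "bij_betw g (carrier N) (carrier P)"
    using isomD(3)[OF f] isomD(3)[OF g] by simp_all
  have img: "f ` carrier M \<subseteq> carrier N"
    using bij by (auto simp: bij_betw_def)
  note tup = map_tuples[OF _ img]
  show ?thesis
    unfolding isom_def
  proof (intro conjI ballI)
    show "bij_betw (g \<circ> f) (carrier M) (carrier P)"
      using bij by (rule bij_betw_trans)
  next
    fix F xs assume F: "F \<in> fun_syms L" "xs \<in> tuples (carrier M) (fun_ar L F)"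
    then have "f (fun_of M F xs) = fun_of N F (map f xs)"
      by (rule isomD(4)[OF f])
    moreover have "g (fun_of N F (map f xs)) = fun_of P F (map g (map f xs))"
      using F tup by (intro isomD(4)[OF g])
    ultimately show "(g \<circ> f) (fun_of M F xs) = fun_of P F (map (g \<circ> f) xs)"
      by simp
  next
    fix R xs assume R: "R \<in> rel_syms L" "xs \<in> tuples (carrier M) (rel_ar L R)"
    then have "xs \<in> rel_of M R \<longleftrightarrow> map f xs \<in> rel_of N R"
      by (rule isomD(5)[OF f])
    moreover have "map f xs \<in> rel_of N R \<longleftrightarrow> map g (map f xs) \<in> rel_of P R"
      using R tup by (intro isomD(5)[OF g])
    ultimately show "xs \<in> rel_of M R \<longleftrightarrow> map (g \<circ> f) xs \<in> rel_of P R"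
      by simp
  qed (use isomD(1)[OF f] isomD(2)[OF g] in simp_all)
qed

text \<open>A left inverse on \<open>carrier M\<close> is automatically two-sided, because
  \<open>f\<close> is onto \<open>carrier N\<close>. Leaving \<open>g\<close> otherwise arbitrary
  lets the inverse of an automorphism of \<open>\<CC>\<close> serve as the inverse of its
  restriction to a submodel.\<close>

lemma isom_inverse:
  assumes f: "isom L f M N" and gf: "\<And>x. x \<in> carrier M \<Longrightarrow> g (f x) = x"
  shows "isom L g N M"
proof -
  have bij: "bij_betw f (carrier M) (carrier N)" and strM: "is_struct L M"
    using isomD(1,3)[OF f] by simp_all
  \<comment> \<open>Surjectivity of \<open>f\<close> writes \<open>y\<close> as \<open>f x\<close>,
    and then \<open>g y\<close> is \<open>x\<close>.\<close>
  have "g y \<in> carrier M \<and> f (g y) = y" if y: "y \<in> carrier N" for y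
  proof -
    obtain x where "x \<in> carrier M" "y = f x"
      using y bij unfolding bij_betw_def by blast
    then show ?thesis
      using gf by simp
  qed
  then have img: "g ` carrier N \<subseteq> carrier M" and fg: "\<And>y. y \<in> carrier N \<Longrightarrow> f (g y) = y"
    by blast+
  have fg_map: "map f (map g ys) = ys" if "ys \<in> tuples (carrier N) n" for ys n
    using that fg unfolding map_map tuples_def by (intro map_idI) auto
  note tup = map_tuples[OF _ img]
  show ?thesis
    unfolding isom_def
  proof (intro conjI ballI)
    show "bij_betw g (carrier N) (carrier M)"
    proof (rule bij_betw_byWitness[where f' = f])
      show "f ` carrier M \<subseteq> carrier N"
        using bij by (simp add: bij_betw_def)
    qed (use gf fg img in blast)+
  next
    fix F ys assume F: "F \<in> fun_syms L" "ys \<in> tuples (carrier N) (fun_ar L F)"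
    \<comment> \<open>Compatibility of \<open>f\<close> is used at the pulled-back tuple
      \<open>map g ys\<close>; applying \<open>g\<close> to both sides then gives compatibility of
      \<open>g\<close>.\<close>
    have "f (fun_of M F (map g ys)) = fun_of N F ys"
      using isomD(4)[OF f F(1) tup[OF F(2)]] fg_map[OF F(2)] by (simp del: map_map)
    then show "g (fun_of N F ys) = fun_of M F (map g ys)"
      using gf[OF fun_of_closed[OF strM F(1) tup[OF F(2)]]] by simp
  next
    fix R ys assume R: "R \<in> rel_syms L" "ys \<in> tuples (carrier N) (rel_ar L R)"
    show "ys \<in> rel_of N R \<longleftrightarrow> map g ys \<in> rel_of M R"
      using isomD(5)[OF f R(1) tup[OF R(2)]] fg_map[OF R(2)] by (simp del: map_map)
  qed (use isomD(1,2)[OF f] in simp_all)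
qed

text \<open>\<open>image_struct\<close> evaluates a function by pulling its arguments back with
  \<open>inv_into\<close>; injectivity makes this pullback cancel \<open>map f\<close>. Outside the
  image it returns \<open>undefined\<close>, as the extensional notion of structure demands.\<close>

lemma isom_image_struct:
  assumes M: "is_struct L M" and inj: "inj_on f (carrier M)"
  shows "isom L f M (image_struct L f M)"
proof -
  let ?N = "image_struct L f M"
  let ?g = "inv_into (carrier M) f"
  have carrier: "carrier ?N = f ` carrier M"
    by (simp add: image_struct_def)
  have g_tup: "map ?g ys \<in> tuples (carrier M) n" if "ys \<in> tuples (f ` carrier M) n" for ys n
    using that by (rule map_tuples) (auto intro: inv_into_into)
  have f_tup: "map f xs \<in> tuples (f ` carrier M) n" if "xs \<in> tuples (carrier M) n" for xs n
    using that by (rule map_tuples) simp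
  have gf_map: "map ?g (map f xs) = xs" if "xs \<in> tuples (carrier M) n" for xs n
    using that inj by (auto simp: tuples_def intro!: map_idI)
  have rel_tup: "rel_of M R \<subseteq> (if R \<in> rel_syms L then tuples (carrier M) (rel_ar L R) else {})" for R
    using M unfolding is_struct_def by blast
  have "is_struct L ?N"
    unfolding is_struct_def
  proof (intro conjI allI)
    show "carrier ?N \<noteq> {}"
      using M by (simp add: carrier is_struct_def)
  next
    fix F ys
    show "if F \<in> fun_syms L \<and> ys \<in> tuples (carrier ?N) (fun_ar L F)
      then fun_of ?N F ys \<in> carrier ?N else fun_of ?N F ys = undefined"
      using fun_of_closed[OF M _ g_tup] by (auto simp: image_struct_def)
  next
    fix R
    show "rel_of ?N R \<subseteq> (if R \<in> rel_syms L then tuples (carrier ?N) (rel_ar L R) else {})"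
      using rel_tup[of R] f_tup by (auto simp: image_struct_def split: if_splits)
  qed
  moreover have "xs \<in> rel_of M R \<longleftrightarrow> map f xs \<in> rel_of ?N R"
    if R: "R \<in> rel_syms L" "xs \<in> tuples (carrier M) (rel_ar L R)" for R xs
  proof
    assume "map f xs \<in> rel_of ?N R"
    then obtain zs where zs: "zs \<in> rel_of M R" "map f xs = map f zs"
      by (auto simp: image_struct_def)
    \<comment> \<open>\<open>f\<close> is injective only on \<open>carrier M\<close>, so
      \<open>zs\<close> must be placed there before equal images give equal tuples.\<close>
    then have "zs \<in> tuples (carrier M) (rel_ar L R)"
      using rel_tup[of R] R(1) by auto
    then have "xs = zs"
      using gf_map R(2) zs(2) by metis
    then show "xs \<in> rel_of M R"
      using zs by simp
  qed (simp add: image_struct_def)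
  moreover have "f (fun_of M F xs) = fun_of ?N F (map f xs)"
    if "F \<in> fun_syms L" "xs \<in> tuples (carrier M) (fun_ar L F)" for F xs
    using that f_tup gf_map[OF that(2)] by (simp add: image_struct_def del: map_map)
  moreover have "bij_betw f (carrier M) (carrier ?N)"
    using inj by (simp add: bij_betw_def carrier)
  ultimately show ?thesis
    using M unfolding isom_def by blast
qed

section \<open>Automorphisms and Galois types\<close>

lemma aut_carrier:
  assumes "f \<in> aut L M" "x \<in> carrier M"
  shows "f x \<in> carrier M"
  using assms bij_betwE[OF isomD(3)] unfolding aut_def by blast

lemma aut_comp:
  assumes "f \<in> aut L M" "g \<in> aut L M"
  shows "g \<circ> f \<in> aut L M"
  using assms isom_comp unfolding aut_def by blast

text \<open>Automorphisms are total functions on \<open>'a\<close> constrained only on the carrier,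
  so the two inverse laws are confined to it.\<close>

lemma aut_inverse:
  assumes "f \<in> aut L M"
  obtains g where "g \<in> aut L M"
    and "\<And>x. x \<in> carrier M \<Longrightarrow> g (f x) = x" and "\<And>x. x \<in> carrier M \<Longrightarrow> f (g x) = x"
proof
  let ?g = "inv_into (carrier M) f"
  have f: "isom L f M M"
    using assms by (simp add: aut_def)
  have inj: "inj_on f (carrier M)" and img: "f ` carrier M = carrier M"
    using isomD(3)[OF f] by (simp_all add: bij_betw_def)
  show gf: "?g (f x) = x" if "x \<in> carrier M" for x
    using inj that by simp
  show "f (?g x) = x" if "x \<in> carrier M" for x
    using img that by (simp add: f_inv_into_f)
  show "?g \<in> aut L M"
    using isom_inverse[OF f gf] by (simp add: aut_def)
qed

text \<open>Up to values off the carrier, the automorphisms fixing \<open>M\<close> form a group,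
  and two orbits coincide as soon as one representative can be moved to the other.\<close>

lemma gtp_eq_iff:
  assumes \<CC>: "is_struct L \<CC>" and M: "carrier M \<subseteq> carrier \<CC>" and a: "a ` I \<subseteq> carrier \<CC>"
  shows "gtp L \<CC> I b M = gtp L \<CC> I a M \<longleftrightarrow>
    (\<exists>f \<in> aut L \<CC>. (\<forall>x \<in> carrier M. f x = x) \<and> (\<forall>i \<in> I. f (a i) = b i))"
proof
  \<comment> \<open>The identity puts \<open>b\<close> into its own orbit; since that is also the
    orbit of \<open>a\<close>, some \<open>f\<close> sends \<open>a\<close> to
    \<open>b\<close>.\<close>
  have "restrict (id \<circ> b) I \<in> gtp L \<CC> I b M"
    using isom_id[OF \<CC>] unfolding gtp_def aut_def by fastforce
  moreover assume "gtp L \<CC> I b M = gtp L \<CC> I a M"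
  ultimately obtain f where f: "f \<in> aut L \<CC>" "\<forall>x \<in> carrier M. f x = x"
    and eq: "restrict (id \<circ> b) I = restrict (f \<circ> a) I"
    unfolding gtp_def by blast
  have "f (a i) = b i" if "i \<in> I" for i
    using fun_cong[OF eq, of i] that by simp
  with f show "\<exists>f \<in> aut L \<CC>. (\<forall>x \<in> carrier M. f x = x) \<and> (\<forall>i \<in> I. f (a i) = b i)"
    by blast
next
  assume "\<exists>f \<in> aut L \<CC>. (\<forall>x \<in> carrier M. f x = x) \<and> (\<forall>i \<in> I. f (a i) = b i)"
  then obtain f where f: "f \<in> aut L \<CC>" "\<forall>x \<in> carrier M. f x = x" and fa: "\<forall>i \<in> I. f (a i) = b i"
    by blast
  obtain g where g: "g \<in> aut L \<CC>" and gf: "\<And>x. x \<in> carrier \<CC> \<Longrightarrow> g (f x) = x"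
    using aut_inverse[OF f(1)] by blast
  have g_fix: "g x = x" if "x \<in> carrier M" for x
    using gf[of x] f(2) M that by auto
  \<comment> \<open>\<open>g\<close> undoes \<open>f\<close> only inside \<open>\<CC>\<close>, so
    this uses that \<open>a\<close> lies there.\<close>
  have gb: "g (b i) = a i" if "i \<in> I" for i
    using gf[of "a i"] fa a that by auto
  have "restrict (h \<circ> b) I \<in> gtp L \<CC> I a M"
    if "h \<in> aut L \<CC>" "\<forall>x \<in> carrier M. h x = x" for h
  proof -
    \<comment> \<open>Precomposing with \<open>f\<close> turns an image of \<open>b\<close> into an
      image of \<open>a\<close>; the other inclusion precomposes with \<open>g\<close>.\<close>
    have "restrict (h \<circ> b) I = restrict ((h \<circ> f) \<circ> a) I"
      using fa by (auto simp: restrict_def)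
    then show ?thesis
      unfolding gtp_def using aut_comp[OF f(1) that(1)] f(2) that(2) by fastforce
  qed
  moreover have "restrict (h \<circ> a) I \<in> gtp L \<CC> I b M"
    if "h \<in> aut L \<CC>" "\<forall>x \<in> carrier M. h x = x" for h
  proof -
    have "restrict (h \<circ> a) I = restrict ((h \<circ> g) \<circ> b) I"
      using gb by (auto simp: restrict_def)
    then show ?thesis
      unfolding gtp_def using aut_comp[OF g that(1)] g_fix that(2) by fastforce
  qed
  ultimately have "gtp L \<CC> I b M \<subseteq> gtp L \<CC> I a M" "gtp L \<CC> I a M \<subseteq> gtp L \<CC> I b M"
    unfolding gtp_def[of L \<CC> I b M] gtp_def[of L \<CC> I a M] by blast+
  then show "gtp L \<CC> I b M = gtp L \<CC> I a M"
    by (rule equalityI)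
qed

section \<open>Properties of non-forking\<close>

text \<open>Both structures inherit their functions and relations from \<open>P\<close>, so only the
  inclusion of carriers is left to know. This supplies the substructure premise of
  \<open>coherence\<close>.\<close>

lemma substruct_of_common_superstruct:
  assumes "substruct L M P" "substruct L N P" "carrier M \<subseteq> carrier N"
  shows "substruct L M N"
proof -
  have "tuples (carrier M) n \<subseteq> tuples (carrier N) n" for n
    using assms(3) by (auto simp: tuples_def)
  then show ?thesis
    using assms unfolding substruct_def by (auto simp: subset_iff)
qed

context aec
begin

section \<open>Strong substructures, small models and their images\<close>

lemma le_carrier: "le M N \<Longrightarrow> carrier M \<subseteq> carrier N"
  using le_substruct by (auto simp: substruct_def)

lemma le_is_struct: "le M N \<Longrightarrow> is_struct L M"
  using le_K K_struct by blast

lemma small_model_mono: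
  assumes "small_model le \<CC> \<mu> N" "le M N"
  shows "small_model le \<CC> \<mu> M"
  using assms le_trans ordLeq_ordLess_trans[OF card_of_mono1[OF le_carrier]]
  unfolding small_model_def by blast

text \<open>The same map \<open>f\<close> is an isomorphism of \<open>N\<close> onto
  \<open>N'\<close> and, restricted, of \<open>M\<close> onto its image, so \<open>le_iso\<close>
  carries the pair across.\<close>

lemma le_image_struct:
  assumes "le M N" and "inj_on f (carrier N)" and "isom L f N N'"
  shows "le (image_struct L f M) N'"
  using le_iso[OF assms(1,3) isom_image_struct]
    le_is_struct[OF assms(1)] inj_on_subset[OF assms(2) le_carrier[OF assms(1)]] .

lemma small_model_image_struct:
  assumes "f \<in> aut L \<CC>" "small_model le \<CC> \<mu> M"
  shows "small_model le \<CC> \<mu> (image_struct L f M)"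
proof -
  have "isom L f \<CC> \<CC>" "inj_on f (carrier \<CC>)"
    using assms(1) isomD(3) unfolding aut_def bij_betw_def by blast+
  then have "le (image_struct L f M) \<CC>"
    using assms(2) le_image_struct by (auto simp: small_model_def)
  moreover have "|f ` carrier M| <o \<mu>"
    using assms(2) card_of_image ordLeq_ordLess_trans unfolding small_model_def by blast
  ultimately show ?thesis
    by (simp add: small_model_def image_struct_def)
qed

section \<open>Non-forking expressed through automorphisms fixing the small model\<close>

lemma nonforkingI:
  fixes \<kappa> :: "'k rel"
  assumes "small_set \<CC> \<mu> A" "small_model le \<CC> \<mu> M0" "small_model le \<CC> \<mu> N" "le M0 N"
    and real: "\<And>\<alpha> (a :: 'k \<Rightarrow> 'a) N'. \<alpha> \<in> Field \<kappa> \<Longrightarrow> a ` underS \<kappa> \<alpha> \<subseteq> A \<Longrightarrow> le N' N \<Longrightarrow>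
      |carrier N'| <o \<kappa> \<Longrightarrow>
      \<exists>f \<in> aut L \<CC>. (\<forall>x \<in> carrier N'. f x = x) \<and> f ` a ` underS \<kappa> \<alpha> \<subseteq> carrier M0"
  shows "nonforking L le \<CC> \<mu> \<kappa> A M0 N"
  unfolding nonforking_def
proof (intro conjI ballI allI impI)
  fix \<alpha> and a :: "'k \<Rightarrow> 'a" and N'
  assume \<alpha>: "\<alpha> \<in> Field \<kappa>"
    and "a ` underS \<kappa> \<alpha> \<subseteq> A \<and> le N' N \<and> |carrier N'| <o \<kappa>"
  then have a: "a ` underS \<kappa> \<alpha> \<subseteq> A" and N': "le N' N" "|carrier N'| <o \<kappa>"
    by auto
  obtain f where f: "f \<in> aut L \<CC>" "\<forall>x \<in> carrier N'. f x = x" "f ` a ` underS \<kappa> \<alpha> \<subseteq> carrier M0"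
    using real[OF \<alpha> a N'] by blast
  have "le N \<CC>"
    using assms(3) by (simp add: small_model_def)
  then have "is_struct L \<CC>" "carrier N' \<subseteq> carrier \<CC>"
    using N'(1) le_trans le_K K_struct le_carrier by blast+
  moreover have "a ` underS \<kappa> \<alpha> \<subseteq> carrier \<CC>"
    using a assms(1) by (auto simp: small_set_def)
  \<comment> \<open>The realization in \<open>M0\<close> is \<open>f \<circ> a\<close>;
    \<open>f\<close> itself witnesses that its type over \<open>N'\<close> is that of
    \<open>a\<close>.\<close>
  ultimately have "gtp L \<CC> (underS \<kappa> \<alpha>) (f \<circ> a) N' = gtp L \<CC> (underS \<kappa> \<alpha>) a N'"
    using f by (auto simp: gtp_eq_iff)
  moreover have "(f \<circ> a) ` underS \<kappa> \<alpha> \<subseteq> carrier M0"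
    using f(3) by auto
  ultimately show "\<exists>b. b ` underS \<kappa> \<alpha> \<subseteq> carrier M0 \<and>
      gtp L \<CC> (underS \<kappa> \<alpha>) b N' = gtp L \<CC> (underS \<kappa> \<alpha>) a N'"
    by blast
qed (use assms(1-4) in simp_all)

lemma nonforkingD:
  assumes "nonforking L le \<CC> \<mu> \<kappa> A M0 N"
  shows "small_set \<CC> \<mu> A" "small_model le \<CC> \<mu> M0" "small_model le \<CC> \<mu> N" "le M0 N"
  using assms unfolding nonforking_def by blast+

text \<open>Elimination counterpart of \<open>nonforkingI\<close>: a realization of the type yields
  an automorphism moving \<open>a\<close> into \<open>M0\<close>. With these two rules the later
  arguments compose automorphisms and no longer mention \<open>gtp\<close>.\<close>

lemma nonforking_realize:
  assumes nf: "nonforking L le \<CC> \<mu> \<kappa> A M0 N" and \<alpha>: "\<alpha> \<in> Field \<kappa>"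
    and a: "a ` underS \<kappa> \<alpha> \<subseteq> A" and N': "le N' N" "|carrier N'| <o \<kappa>"
  obtains f where "f \<in> aut L \<CC>" "\<forall>x \<in> carrier N'. f x = x" "f ` a ` underS \<kappa> \<alpha> \<subseteq> carrier M0"
proof -
  obtain b where b: "b ` underS \<kappa> \<alpha> \<subseteq> carrier M0"
    "gtp L \<CC> (underS \<kappa> \<alpha>) b N' = gtp L \<CC> (underS \<kappa> \<alpha>) a N'"
    using nf \<alpha> a N' unfolding nonforking_def by blast
  have "le N \<CC>"
    using nonforkingD(3)[OF nf] by (simp add: small_model_def)
  then have \<CC>: "is_struct L \<CC>" "carrier N' \<subseteq> carrier \<CC>"
    using N'(1) le_trans le_K K_struct le_carrier by blast+
  have "a ` underS \<kappa> \<alpha> \<subseteq> carrier \<CC>"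
    using a nonforkingD(1)[OF nf] by (auto simp: small_set_def)
  then obtain f where f: "f \<in> aut L \<CC>" "\<forall>x \<in> carrier N'. f x = x"
    and fa: "\<forall>i \<in> underS \<kappa> \<alpha>. f (a i) = b i"
    using gtp_eq_iff[OF \<CC>, THEN iffD1, OF _ b(2)] by blast
  have "f ` a ` underS \<kappa> \<alpha> \<subseteq> carrier M0"
    using b(1) fa by auto
  with f show thesis
    by (rule that)
qed

section \<open>Invariance, monotonicity and transitivity\<close>

lemma nonforking_Invariance: "Invariance L \<CC> (nonforking L le \<CC> \<mu> \<kappa>)"
  unfolding Invariance_def
proof (intro allI impI, elim conjE)
  fix f A M0 N
  assume f: "f \<in> aut L \<CC>" and nf: "nonforking L le \<CC> \<mu> \<kappa> A M0 N"
  note nfD = nonforkingD[OF nf]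
  have A: "A \<subseteq> carrier \<CC>" "|A| <o \<mu>"
    using nfD(1) by (auto simp: small_set_def)
  have N\<CC>: "carrier N \<subseteq> carrier \<CC>"
    using nfD(3) le_carrier by (auto simp: small_model_def)
  obtain g where g: "g \<in> aut L \<CC>" and gf: "\<And>x. x \<in> carrier \<CC> \<Longrightarrow> g (f x) = x"
    and fg: "\<And>x. x \<in> carrier \<CC> \<Longrightarrow> f (g x) = x"
    using aut_inverse[OF f] by blast
  have inj: "inj_on f (carrier N)"
    using gf N\<CC> by (intro inj_on_inverseI[of _ g]) auto
  have fN: "isom L f N (image_struct L f N)"
    using isom_image_struct[OF _ inj] K_struct le_K nfD(4) by blast
  \<comment> \<open>The global inverse \<open>g\<close> also inverts the restriction of
    \<open>f\<close> to \<open>N\<close>.\<close>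
  then have gN: "isom L g (image_struct L f N) N"
    by (rule isom_inverse) (use gf N\<CC> in auto)
  have smallN: "small_model le \<CC> \<mu> (image_struct L f N)"
    using small_model_image_struct[OF f nfD(3)] .
  show "nonforking L le \<CC> \<mu> \<kappa> (f ` A) (image_struct L f M0) (image_struct L f N)"
  proof (rule nonforkingI)
    show "small_set \<CC> \<mu> (f ` A)"
      using A aut_carrier[OF f] ordLeq_ordLess_trans[OF card_of_image A(2)]
      by (auto simp: small_set_def)
    show "small_model le \<CC> \<mu> (image_struct L f M0)"
      using small_model_image_struct[OF f nfD(2)] .
    show "le (image_struct L f M0) (image_struct L f N)"
      using le_image_struct[OF nfD(4) inj fN] .
  next
    fix \<alpha> a N'
    assume \<alpha>: "\<alpha> \<in> Field \<kappa>" and a: "a ` underS \<kappa> \<alpha> \<subseteq> f ` A"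
      and N': "le N' (image_struct L f N)" "|carrier N'| <o \<kappa>"
    have N'\<CC>: "carrier N' \<subseteq> carrier \<CC>"
      using small_model_mono[OF smallN N'(1)] le_carrier by (auto simp: small_model_def)
    \<comment> \<open>The instance is pulled back along \<open>g\<close>: \<open>N'\<close> becomes
      a small strong submodel of \<open>N\<close>, and \<open>a\<close> becomes a sequence in
      \<open>A\<close>.\<close>
    have "inj_on g (carrier (image_struct L f N))"
      using isomD(3)[OF gN] by (simp add: bij_betw_def)
    then have "le (image_struct L g N') N"
      using le_image_struct[OF N'(1) _ gN] by blast
    moreover have "|carrier (image_struct L g N')| <o \<kappa>"
      using ordLeq_ordLess_trans[OF card_of_image N'(2)] by (simp add: image_struct_def)
    moreover have "(g \<circ> a) ` underS \<kappa> \<alpha> \<subseteq> A"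
    proof -
      have "g ` a ` underS \<kappa> \<alpha> \<subseteq> g ` f ` A"
        using a by blast
      also have "\<dots> \<subseteq> A"
        using gf A(1) by auto
      finally show ?thesis
        by (simp add: image_comp)
    qed
    ultimately obtain h where h: "h \<in> aut L \<CC>"
      and h_fix: "\<forall>x \<in> carrier (image_struct L g N'). h x = x"
      and im: "h ` (g \<circ> a) ` underS \<kappa> \<alpha> \<subseteq> carrier M0"
      using nonforking_realize[OF nf \<alpha>, of "g \<circ> a" "image_struct L g N'"] by blast
    \<comment> \<open>For \<open>x\<close> in \<open>N'\<close>, \<open>h\<close> fixes
      \<open>g x\<close> and \<open>f\<close> returns it to \<open>x\<close>; and since
      \<open>h\<close> moves \<open>g \<circ> a\<close> into \<open>M0\<close>, the conjugate moves
      \<open>a\<close> into the image of \<open>M0\<close>.\<close>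
    have "f \<circ> h \<circ> g \<in> aut L \<CC>"
      using f g h by (simp add: aut_comp)
    moreover have "\<forall>x \<in> carrier N'. (f \<circ> h \<circ> g) x = x"
      using h_fix fg N'\<CC> by (auto simp: image_struct_def)
    moreover have "(f \<circ> h \<circ> g) ` a ` underS \<kappa> \<alpha> \<subseteq> carrier (image_struct L f M0)"
      using im by (auto simp: image_struct_def)
    ultimately show "\<exists>f' \<in> aut L \<CC>. (\<forall>x \<in> carrier N'. f' x = x) \<and>
        f' ` a ` underS \<kappa> \<alpha> \<subseteq> carrier (image_struct L f M0)"
      by blast
  qed (rule smallN)
qed

lemma nonforking_Monotonicity: "Monotonicity le (nonforking L le \<CC> \<mu> \<kappa>)"
  unfolding Monotonicity_def
proof (intro allI impI, elim conjE)
  fix A A' M0 M0' N' N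
  assume nf: "nonforking L le \<CC> \<mu> \<kappa> A M0 N" and A': "A' \<subseteq> A"
    and le: "le M0 M0'" "le M0' N'" "le N' N"
  note nfD = nonforkingD[OF nf]
  show "nonforking L le \<CC> \<mu> \<kappa> A' M0' N'"
  proof (rule nonforkingI)
    show "small_set \<CC> \<mu> A'"
      using nfD(1) A' ordLeq_ordLess_trans[OF card_of_mono1[OF A']] by (auto simp: small_set_def)
    show "small_model le \<CC> \<mu> N'"
      using small_model_mono[OF nfD(3) le(3)] .
    then show "small_model le \<CC> \<mu> M0'"
      using small_model_mono le(2) by blast
  next
    fix \<alpha> a N''
    assume \<alpha>: "\<alpha> \<in> Field \<kappa>" and a: "a ` underS \<kappa> \<alpha> \<subseteq> A'"
      and N'': "le N'' N'" "|carrier N''| <o \<kappa>"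
    \<comment> \<open>\<open>N''\<close> is also strong in \<open>N\<close>, so the given relation
      moves \<open>a\<close> into \<open>M0\<close>, which is contained in
      \<open>M0'\<close>.\<close>
    obtain f where "f \<in> aut L \<CC>" "\<forall>x \<in> carrier N''. f x = x" "f ` a ` underS \<kappa> \<alpha> \<subseteq> carrier M0"
      using nonforking_realize[OF nf \<alpha> subset_trans[OF a A'] le_trans[OF N''(1) le(3)] N''(2)] .
    then show "\<exists>f \<in> aut L \<CC>. (\<forall>x \<in> carrier N''. f x = x) \<and> f ` a ` underS \<kappa> \<alpha> \<subseteq> carrier M0'"
      using le_carrier[OF le(1)] by blast
  qed (rule le(2))
qed

lemma nonforking_Transitivity: "Transitivity le (nonforking L le \<CC> \<mu> \<kappa>)"
  unfolding Transitivity_def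
proof (intro allI impI, elim conjE)
  fix A M0 M0' N
  assume nf: "nonforking L le \<CC> \<mu> \<kappa> A M0' N" and nf': "nonforking L le \<CC> \<mu> \<kappa> (carrier M0') M0 N"
  show "nonforking L le \<CC> \<mu> \<kappa> A M0 N"
  proof (rule nonforkingI)
    fix \<alpha> a N'
    assume \<alpha>: "\<alpha> \<in> Field \<kappa>" and a: "a ` underS \<kappa> \<alpha> \<subseteq> A"
      and N': "le N' N" "|carrier N'| <o \<kappa>"
    obtain f where f: "f \<in> aut L \<CC>" "\<forall>x \<in> carrier N'. f x = x"
      "f ` a ` underS \<kappa> \<alpha> \<subseteq> carrier M0'"
      using nonforking_realize[OF nf \<alpha> a N'] .
    \<comment> \<open>\<open>f \<circ> a\<close> is a sequence of the same length inside
      \<open>M0'\<close>, so the second relation applies to it over the same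
      \<open>N'\<close>.\<close>
    then have "(f \<circ> a) ` underS \<kappa> \<alpha> \<subseteq> carrier M0'"
      by auto
    then obtain g where g: "g \<in> aut L \<CC>" "\<forall>x \<in> carrier N'. g x = x"
      "g ` (f \<circ> a) ` underS \<kappa> \<alpha> \<subseteq> carrier M0"
      using nonforking_realize[OF nf' \<alpha> _ N', of "f \<circ> a"] by blast
    \<comment> \<open>Both automorphisms fix \<open>N'\<close> pointwise, hence so does
      \<open>g \<circ> f\<close>.\<close>
    show "\<exists>f \<in> aut L \<CC>. (\<forall>x \<in> carrier N'. f x = x) \<and> f ` a ` underS \<kappa> \<alpha> \<subseteq> carrier M0"
      using aut_comp[OF f(1) g(1)] f(2) g(2,3) by (intro bexI[of _ "g \<circ> f"]) auto
  qed (use nonforkingD[OF nf] nonforkingD[OF nf'] in auto)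
qed

section \<open>Continuity\<close>

lemma nonforking_Continuity_a:
  assumes "Card_order \<kappa>"
  shows "Continuity_a le \<CC> \<mu> \<kappa> (nonforking L le \<CC> \<mu> \<kappa>)"
  unfolding Continuity_a_def
proof (intro allI impI, elim conjE)
  fix A M0 N
  assume small: "small_set \<CC> \<mu> A" "small_model le \<CC> \<mu> M0" "small_model le \<CC> \<mu> N" "le M0 N"
    and loc: "\<forall>A' N'. A' \<subseteq> A \<and> |A'| <o \<kappa> \<and> le N' N \<and> |carrier N'| <o \<kappa> \<longrightarrow>
      (\<exists>M0' Ns. le M0' M0 \<and> le N' Ns \<and> le Ns N \<and> le M0' Ns \<and> nonforking L le \<CC> \<mu> \<kappa> A' M0' Ns)"
  show "nonforking L le \<CC> \<mu> \<kappa> A M0 N"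
  proof (rule nonforkingI)
    fix \<alpha> a N'
    assume \<alpha>: "\<alpha> \<in> Field \<kappa>" and a: "a ` underS \<kappa> \<alpha> \<subseteq> A"
      and N': "le N' N" "|carrier N'| <o \<kappa>"
    \<comment> \<open>A proper initial segment of a cardinal order has smaller cardinality, so the
      range of \<open>a\<close> may be taken as the small subset \<open>A'\<close>.\<close>
    have "|a ` underS \<kappa> \<alpha>| <o \<kappa>"
      using ordLeq_ordLess_trans[OF card_of_image card_of_underS[OF assms \<alpha>]] .
    then obtain M0' Ns where "le M0' M0" "le N' Ns"
      and nf: "nonforking L le \<CC> \<mu> \<kappa> (a ` underS \<kappa> \<alpha>) M0' Ns"
      using loc a N' by blast
    moreover obtain f where "f \<in> aut L \<CC>" "\<forall>x \<in> carrier N'. f x = x"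
      "f ` a ` underS \<kappa> \<alpha> \<subseteq> carrier M0'"
      using nonforking_realize[OF nf \<alpha> subset_refl \<open>le N' Ns\<close> N'(2)] .
    ultimately show "\<exists>f \<in> aut L \<CC>. (\<forall>x \<in> carrier N'. f x = x) \<and> f ` a ` underS \<kappa> \<alpha> \<subseteq> carrier M0"
      using le_carrier[of M0' M0] by blast
  qed (use small in auto)
qed

text \<open>\<open>LS_bound\<close> puts \<open>natLeq\<close> below \<open>LS\<close>, hence
  strictly below \<open>\<kappa>\<close>. The regularity argument for filtrations needs
  \<open>\<kappa>\<close> infinite.\<close>

lemma Cinfinite_if_LS_less:
  assumes "Card_order \<kappa>" "LS <o \<kappa>"
  shows "Cinfinite \<kappa>"
proof -
  have "natLeq \<le>o natLeq +c |fun_syms L <+> rel_syms L|"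
    by (rule ordLeq_csum1) (rule natLeq_Card_order)
  moreover have "natLeq +c |fun_syms L <+> rel_syms L| \<le>o LS"
    using LS_bound by (simp add: LS_bound_def)
  ultimately have "natLeq <o \<kappa>"
    using assms(2) by (rule ordLeq_ordLess_trans[OF ordLeq_transitive])
  then show ?thesis
    using cinfinite_mono[OF ordLess_imp_ordLeq natLeq_cinfinite] assms(1) by simp
qed

lemma nonforking_Continuity_b:
  assumes "Cinfinite \<kappa>" "regularCard \<kappa>"
  shows "Continuity_b L le \<CC> \<mu> \<kappa> (nonforking L le \<CC> \<mu> \<kappa>)"
  unfolding Continuity_b_def
proof (intro allI impI, elim conjE)
  fix As A Ms M0 N
  assume small: "small_set \<CC> \<mu> A" "small_model le \<CC> \<mu> M0" "small_model le \<CC> \<mu> N"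
    and As: "set_filtration \<kappa> As A" and Ms: "model_filtration L le \<kappa> Ms M0"
    and nf: "\<forall>i \<in> Field \<kappa>. nonforking L le \<CC> \<mu> \<kappa> (As i) (Ms i) N"
  have M0: "carrier M0 = (\<Union>i \<in> Field \<kappa>. carrier (Ms i))"
    using Ms by (auto simp: model_filtration_def is_union_def)
  then have "carrier M0 \<subseteq> carrier N"
    using nf nonforkingD(4) le_carrier by blast
  \<comment> \<open>The chain axioms concern well-orders on \<open>'a\<close>, whereas this chain is
    indexed by \<open>\<kappa>\<close> on \<open>'k\<close>. Instead \<open>coherence\<close> is
    applied inside \<open>\<CC>\<close>, in which both \<open>M0\<close> and \<open>N\<close> are
    strong.\<close>
  then have "le M0 N"
    using coherence[OF _ _ substruct_of_common_superstruct[OF le_substruct le_substruct]] small(2,3)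
    unfolding small_model_def by blast
  then show "nonforking L le \<CC> \<mu> \<kappa> A M0 N"
  proof (rule nonforkingI[OF small])
    fix \<alpha> a N'
    assume \<alpha>: "\<alpha> \<in> Field \<kappa>" and a: "a ` underS \<kappa> \<alpha> \<subseteq> A"
      and N': "le N' N" "|carrier N'| <o \<kappa>"
    have "|a ` underS \<kappa> \<alpha>| <o \<kappa>"
      using ordLeq_ordLess_trans[OF card_of_image card_of_underS[OF _ \<alpha>]] assms(1) by blast
    moreover have "relChain \<kappa> As" "a ` underS \<kappa> \<alpha> \<subseteq> (\<Union>i \<in> Field \<kappa>. As i)"
      using As a by (auto simp: set_filtration_def relChain_def)
    \<comment> \<open>By regularity, fewer than \<open>\<kappa>\<close> elements of an increasing
      union of length \<open>\<kappa>\<close> already appear at one stage.\<close>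
    ultimately obtain i where i: "i \<in> Field \<kappa>" "a ` underS \<kappa> \<alpha> \<subseteq> As i"
      using regularCard_UNION[of \<kappa> As] assms unfolding cinfinite_def by blast
    have "carrier (Ms i) \<subseteq> carrier M0"
      using M0 i(1) by blast
    moreover obtain f where "f \<in> aut L \<CC>" "\<forall>x \<in> carrier N'. f x = x"
      "f ` a ` underS \<kappa> \<alpha> \<subseteq> carrier (Ms i)"
      using nonforking_realize[OF bspec[OF nf i(1)] \<alpha> i(2) N'] .
    ultimately show "\<exists>f \<in> aut L \<CC>. (\<forall>x \<in> carrier N'. f x = x) \<and> f ` a ` underS \<kappa> \<alpha> \<subseteq> carrier M0"
      by blast
  qed
qed

end

theorem theorem4p4:
  fixes L :: "('f, 'r) lang"
    and K :: "('a, 'f, 'r) struct set"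
    and le :: "('a, 'f, 'r) struct \<Rightarrow> ('a, 'f, 'r) struct \<Rightarrow> bool"
    and LS :: "'l rel"
    and \<CC> :: "('a, 'f, 'r) struct"
    and \<mu> :: "'m rel"
    and \<kappa> :: "'k rel"
    and lam :: "'j rel"
  assumes "aec L K le LS"
    and "amalgamation L K le"
    and "joint_embedding L K le"
    and "no_maximal_models L K le"
    and "monster L K le \<CC> \<mu>"
    and "Card_order \<kappa>"
    and "Card_order lam"
    and "LS <o \<kappa>"
    and "\<kappa> \<le>o lam"
    and "lam <o \<mu>"
  shows "Invariance L \<CC> (nonforking L le \<CC> \<mu> \<kappa>) \<and>
         Monotonicity le (nonforking L le \<CC> \<mu> \<kappa>) \<and>
         Transitivity le (nonforking L le \<CC> \<mu> \<kappa>) \<and>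
         Continuity_a le \<CC> \<mu> \<kappa> (nonforking L le \<CC> \<mu> \<kappa>) \<and>
         (regularCard \<kappa> \<longrightarrow> Continuity_b L le \<CC> \<mu> \<kappa> (nonforking L le \<CC> \<mu> \<kappa>))"
proof -
  interpret aec L K le LS
    by fact
  show ?thesis
    \<comment> \<open>That \<open>\<kappa>\<close> is a cardinal serves both continuity clauses;
      with \<open>LS <o \<kappa>\<close> it makes \<open>\<kappa>\<close> infinite for the second,
      whose regularity premise comes from the implication.\<close>
    using assms(6,8)
    by (intro conjI impI nonforking_Invariance nonforking_Monotonicity nonforking_Transitivity
        nonforking_Continuity_a nonforking_Continuity_b Cinfinite_if_LS_less)
qed

end
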